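(* Let $G=(V,E)$ be a finite factor-critical graph given with an odd ear-decomposition $G=P_0+P_1+\cdots+P_k$, and let $e=ab\in E$ be an odd edge (with respect to this ear-decomposition) that is an edge of a nontrivial ear. Then for any vertex $v\in V$ with $\mathrm{ear}(v)<\mathrm{ear}(a)=\mathrm{ear}(b)$, there exists a perfect matching of $G-v$ containing $e$.
   Context: Graphs are finite, without loops or parallel edges. A matching is a set of pairwise vertex-disjoint edges; it is perfect if it covers all vertices. A graph $G$ is factor-critical if $G-v$ has a perfect matching for every vertex $v$. An ear-decomposition $G=P_0+P_1+\cdots+P_k$ consists of a circuit $P_0$ and paths $P_1,\ldots,P_k$ whose edge sets partition the edge set of $G$ and whose vertex sets together cover $V(G)$, such that for each $i\in\{1,\ldots,k\}$ the path $P_i$ (which has at least one edge) shares exactly its endpoints with $V(P_0)\cup\cdots\cup V(P_{i-1})$. The two endpoints of $P_i$ may coincide, in which case $P_i$ is a circuit having exactly one vertex, its "endpoint", in common with $V(P_0)\cup\cdots\cup V(P_{i-1})$. The $P_i$ are called ears. An ear is trivial if it consists of a single edge, and nontrivial otherwise. An ear is odd if it has an odd number of edges. The ear-decomposition is odd if all of $P_0,P_1,\ldots,P_k$ (including the circuit $P_0$) have an odd number of edges. For $v\in V$, $\mathrm{ear}(v)$ is the smallest index $i\in\{0,\ldots,k\}$ with $v\in V(P_i)$. Given an ear-decomposition, an edge $e=ab$ of $G$ is called odd if $\mathrm{ear}(a)=\mathrm{ear}(b)=:i$ and, in case $i\ge 1$, additionally: $a$ is joined to an endpoint of $P_i$ by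 a subpath of $P_i$ that has an odd number of edges and does not contain $b$, and likewise $b$ is joined to an endpoint of $P_i$ by a subpath of $P_i$ that has an odd number of edges and does not contain $a$. *)

theory Defs
  imports Main "HOL-Library.Disjoint_Sets"
begin

definition simple_graph :: "'a set \<Rightarrow> 'a set set \<Rightarrow> bool" where
  "simple_graph V E \<longleftrightarrow> finite V \<and> (\<forall>e\<in>E. e \<subseteq> V \<and> card e = 2)"

definition matching :: "'a set set \<Rightarrow> 'a set set \<Rightarrow> bool" where
  "matching E M \<longleftrightarrow> M \<subseteq> E \<and> pairwise disjnt M"

definition perfect_matching :: "'a set \<Rightarrow> 'a set set \<Rightarrow> 'a set set \<Rightarrow> bool" where
  "perfect_matching V E M \<longleftrightarrow> matching E M \<and> \<Union>M = V"

text \<open>The graph \<open>G - v\<close> has vertex set \<open>V - {v}\<close> and edge set \<open>del_vertex E v\<close>.\<close>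

definition del_vertex :: "'a set set \<Rightarrow> 'a \<Rightarrow> 'a set set" where
  "del_vertex E v = {e \<in> E. v \<notin> e}"

definition factor_critical :: "'a set \<Rightarrow> 'a set set \<Rightarrow> bool" where
  "factor_critical V E \<longleftrightarrow> (\<forall>v\<in>V. \<exists>M. perfect_matching (V - {v}) (del_vertex E v) M)"

text \<open>Paths and circuits are given by the list of their vertices in order of traversal; the list
  of a circuit repeats its first vertex at the end. In both cases the number of edges is the length
  of the list minus one.\<close>

definition walk_edges :: "'a list \<Rightarrow> 'a set set" where
  "walk_edges p = {{p ! i, p ! Suc i} | i. Suc i < length p}"

definition num_edges :: "'a list \<Rightarrow> nat" where
  "num_edges p = length p - 1"

definition is_path :: "'a list \<Rightarrow> bool" where
  "is_path p \<longleftrightarrow> p \<noteq> [] \<and> distinct p"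

definition is_circuit :: "'a list \<Rightarrow> bool" where
  "is_circuit p \<longleftrightarrow> num_edges p \<ge> 3 \<and> hd p = last p \<and> distinct (tl p)"

text \<open>The ears are \<open>P 0, \<dots>, P k\<close>; values of \<open>P\<close> beyond \<open>k\<close> are irrelevant. The endpoints of
  an ear \<open>P i\<close> with \<open>i \<ge> 1\<close> are \<open>hd (P i)\<close> and \<open>last (P i)\<close>. So a closed ear is listed
  starting from the one vertex it shares with the earlier ears.\<close>

definition ear_decomposition ::
  "'a set \<Rightarrow> 'a set set \<Rightarrow> nat \<Rightarrow> (nat \<Rightarrow> 'a list) \<Rightarrow> bool" where
  "ear_decomposition V E k P \<longleftrightarrow>
     is_circuit (P 0) \<and>
     (\<forall>i\<in>{1..k}. (is_path (P i) \<or> is_circuit (P i)) \<and> num_edges (P i) \<ge> 1 \<and>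
        set (P i) \<inter> (\<Union>j<i. set (P j)) = {hd (P i), last (P i)}) \<and>
     disjoint_family_on (\<lambda>i. walk_edges (P i)) {..k} \<and>
     (\<Union>i\<le>k. walk_edges (P i)) = E \<and>
     (\<Union>i\<le>k. set (P i)) = V"

definition odd_ear_decomposition ::
  "'a set \<Rightarrow> 'a set set \<Rightarrow> nat \<Rightarrow> (nat \<Rightarrow> 'a list) \<Rightarrow> bool" where
  "odd_ear_decomposition V E k P \<longleftrightarrow>
     ear_decomposition V E k P \<and> (\<forall>i\<le>k. odd (num_edges (P i)))"

definition trivial_ear :: "'a list \<Rightarrow> bool" where
  "trivial_ear p \<longleftrightarrow> num_edges p = 1"

definition ear :: "nat \<Rightarrow> (nat \<Rightarrow> 'a list) \<Rightarrow> 'a \<Rightarrow> nat" where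
  "ear k P v = (LEAST i. i \<le> k \<and> v \<in> set (P i))"

text \<open>A subpath is a path that is a subgraph of the ear \<open>p\<close>; it may run in either direction
  along \<open>p\<close>.\<close>

definition subpath_of :: "'a list \<Rightarrow> 'a list \<Rightarrow> bool" where
  "subpath_of q p \<longleftrightarrow> is_path q \<and> set q \<subseteq> set p \<and> walk_edges q \<subseteq> walk_edges p"

definition oddly_joined_avoiding :: "'a list \<Rightarrow> 'a \<Rightarrow> 'a \<Rightarrow> bool" where
  "oddly_joined_avoiding p a b \<longleftrightarrow>
     (\<exists>q. subpath_of q p \<and> hd q = a \<and> last q \<in> {hd p, last p} \<and>
          odd (num_edges q) \<and> b \<notin> set q)"

definition odd_edge ::
  "'a set set \<Rightarrow> nat \<Rightarrow> (nat \<Rightarrow> 'a list) \<Rightarrow> 'a \<Rightarrow> 'a \<Rightarrow> bool" where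
  "odd_edge E k P a b \<longleftrightarrow>
     {a, b} \<in> E \<and> ear k P a = ear k P b \<and>
     (ear k P a \<ge> 1 \<longrightarrow>
        oddly_joined_avoiding (P (ear k P a)) a b \<and>
        oddly_joined_avoiding (P (ear k P a)) b a)"

end

theory Submission
  imports Defs
begin

text \<open>Write \<open>W\<^sub>j\<close> for the vertices of \<open>P\<^sub>0 + \<dots> + P\<^sub>j\<close>. The inner vertices of an odd ear are even in
  number, so they can be matched along the ear by taking every second edge; hence a perfect matching
  of \<open>W\<^sub>j - v\<close> extends to one of \<open>W\<^sub>j\<^sub>+\<^sub>1 - v\<close>, and by induction every \<open>P\<^sub>0 + \<dots> + P\<^sub>j\<close> is
  factor-critical. Let \<open>i = ear(a) = ear(b)\<close>. A nontrivial ear containing \<open>e\<close> must be \<open>P\<^sub>i\<close>, with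
  \<open>a\<close> and \<open>b\<close> inner vertices, and oddness of \<open>e\<close> says that it is one of the edges chosen when the
  inner vertices of \<open>P\<^sub>i\<close> are matched. So start with a perfect matching of \<open>W\<^sub>i\<^sub>-\<^sub>1 - v\<close> and extend it
  over the ears \<open>P\<^sub>i, \<dots>, P\<^sub>k\<close>.\<close>

section \<open>Perfect matchings and disjoint unions\<close>

lemma perfect_matching_mono:
  assumes "perfect_matching V E M" "E \<subseteq> F"
  shows "perfect_matching V F M"
  using assms by (auto simp: perfect_matching_def matching_def)

lemma perfect_matching_Un:
  assumes "perfect_matching V E M" "perfect_matching W F N" "V \<inter> W = {}"
  shows "perfect_matching (V \<union> W) (E \<union> F) (M \<union> N)"
proof -
  have "disjnt e f" if "e \<in> M" "f \<in> N" for e f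
    using that assms by (auto simp: perfect_matching_def disjnt_def)
  then have "pairwise disjnt (M \<union> N)"
    using assms by (auto simp: perfect_matching_def matching_def pairwise_def disjnt_sym)
  then show ?thesis
    using assms by (auto simp: perfect_matching_def matching_def)
qed

text \<open>A matching that covers exactly \<open>V - {v}\<close> has no edge at \<open>v\<close>,
  so deleting the edges at \<open>v\<close> changes nothing and matchings for different
  \<open>v\<close> can be compared in one edge set.\<close>

lemma perfect_matching_del_vertex:
  "perfect_matching (V - {v}) (del_vertex E v) M \<longleftrightarrow> perfect_matching (V - {v}) E M"
  by (auto simp: perfect_matching_def matching_def del_vertex_def)

section \<open>Edges of walks given as vertex lists\<close>

lemma walk_edges_Cons:
  "walk_edges (x # y # zs) = insert {x, y} (walk_edges (y # zs))"
proof -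
  have image: "walk_edges p = (\<lambda>i. {p ! i, p ! Suc i}) ` {..<length p - 1}" for p :: "'a list"
    by (auto simp: walk_edges_def image_iff)
  show ?thesis
    by (simp add: image lessThan_Suc_eq_insert_0 image_image)
qed

lemma walk_edges_Cons_subset: "walk_edges xs \<subseteq> walk_edges (x # xs)"
  by (cases xs) (auto simp: walk_edges_Cons walk_edges_def[of "[]"])

lemma walk_edges_append1: "walk_edges ys \<subseteq> walk_edges (xs @ ys)"
proof (induction xs)
  case (Cons x xs)
  then show ?case
    using walk_edges_Cons_subset[of "xs @ ys" x] by simp
qed simp

lemma walk_edges_append2: "walk_edges xs \<subseteq> walk_edges (xs @ ys)"
proof
  fix e assume "e \<in> walk_edges xs"
  then obtain i where "Suc i < length xs" "e = {xs ! i, xs ! Suc i}"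
    by (auto simp: walk_edges_def)
  then show "e \<in> walk_edges (xs @ ys)"
    by (auto simp: walk_edges_def nth_append intro!: exI[of _ i])
qed

lemma walk_edges_infix: "walk_edges ys \<subseteq> walk_edges (xs @ ys @ zs)"
  using walk_edges_append1 walk_edges_append2 by blast

lemma walk_edges_subset: "e \<in> walk_edges p \<Longrightarrow> e \<subseteq> set p"
  by (auto simp: walk_edges_def)

section \<open>Taking every second edge of a path\<close>

text \<open>For an even number of distinct vertices this is the unique perfect matching of the path
  they form, so whether an edge of the path belongs to it is a matter of parity.\<close>

fun alternate_edges :: "'a list \<Rightarrow> 'a set set" where
  "alternate_edges (x # y # zs) = insert {x, y} (alternate_edges zs)"
| "alternate_edges _ = {}"

lemma Union_alternate_edges: "even (length xs) \<Longrightarrow> \<Union>(alternate_edges xs) = set xs"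
  by (induction xs rule: alternate_edges.induct) auto

lemma alternate_edges_subset: "alternate_edges xs \<subseteq> walk_edges xs"
proof (induction xs rule: alternate_edges.induct)
  case (1 x y zs)
  then show ?case
    using walk_edges_Cons_subset[of zs y] by (auto simp: walk_edges_Cons)
qed auto

lemma perfect_matching_alternate_edges:
  assumes "distinct xs" "even (length xs)"
  shows "perfect_matching (set xs) (walk_edges xs) (alternate_edges xs)"
  using assms
proof (induction xs rule: alternate_edges.induct)
  case (1 x y zs)
  have "perfect_matching {x, y} {{x, y}} {{x, y}}"
    by (simp add: perfect_matching_def matching_def)
  with 1 have "perfect_matching ({x, y} \<union> set zs) ({{x, y}} \<union> walk_edges zs)
      ({{x, y}} \<union> alternate_edges zs)"
    by (intro perfect_matching_Un) auto
  moreover have "{{x, y}} \<union> walk_edges zs \<subseteq> walk_edges (x # y # zs)"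
    using walk_edges_Cons_subset[of zs y] by (auto simp: walk_edges_Cons)
  ultimately show ?case
    by (auto intro: perfect_matching_mono)
qed (auto simp: perfect_matching_def matching_def)

text \<open>After a prefix of even length no pair straddles the seam.\<close>

lemma alternate_edges_append:
  "even (length xs) \<Longrightarrow> alternate_edges (xs @ ys) = alternate_edges xs \<union> alternate_edges ys"
  by (induction xs rule: alternate_edges.induct) auto

lemma perfect_matching_Un_segment:
  assumes "perfect_matching W F M" "distinct ys" "even (length ys)" "W \<inter> set ys = {}"
    "walk_edges ys \<subseteq> F"
  shows "perfect_matching (W \<union> set ys) F (M \<union> alternate_edges ys)"
  using perfect_matching_Un[OF assms(1) perfect_matching_alternate_edges[OF assms(2,3)] assms(4)]
    assms(5) by (simp add: Un_absorb2)

section \<open>Odd ears preserve factor-criticality\<close>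

text \<open>This treats paths and circuits alike: \<open>x = y\<close> is allowed, and distinctness
  is claimed only for the inner vertices, among themselves and from the ends.\<close>

lemma ear_inner:
  assumes "is_path p \<or> is_circuit p" "num_edges p \<ge> 1"
  obtains x xs y where "p = x # xs @ [y]" "distinct xs" "x \<notin> set xs" "y \<notin> set xs"
proof -
  obtain x r where p: "p = x # r" "r \<noteq> []"
    using assms(2) by (cases p) (fastforce simp: num_edges_def Suc_le_eq)+
  then obtain xs y where "p = x # xs @ [y]"
    by (metis rev_exhaust)
  with assms(1) show thesis
    by (intro that[of x xs y]) (auto simp: is_path_def is_circuit_def)
qed

text \<open>If \<open>v\<close> is old, the inner vertices are matched among themselves. If
  \<open>v\<close> is new, it cuts them into two pieces of opposite parity; the odd piece is
  completed by the endpoint on its side, which the matching of \<open>W\<close> leaves uncovered.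
  The argument also covers closed ears, where \<open>x = y\<close>.\<close>

lemma factor_critical_add_odd_ear:
  assumes fc: "factor_critical W F"
    and inner: "distinct xs" "even (length xs)" "W \<inter> set xs = {}"
    and ends: "x \<in> W" "y \<in> W"
  shows "factor_critical (W \<union> set xs) (F \<union> walk_edges (x # xs @ [y]))"
  unfolding factor_critical_def perfect_matching_del_vertex
proof
  define F' where "F' = F \<union> walk_edges (x # xs @ [y])"
  have old: "\<exists>M. perfect_matching (W - {u}) F' M" if "u \<in> W" for u
    using fc that perfect_matching_mono[of "W - {u}" F _ F']
    unfolding factor_critical_def perfect_matching_del_vertex F'_def by blast
  have segment: "walk_edges ys \<subseteq> F'" if "x # xs @ [y] = us @ ys @ ws" for us ys ws
    using walk_edges_infix[of ys us ws] that by (auto simp: F'_def)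
  fix v assume v: "v \<in> W \<union> set xs"
  show "\<exists>M. perfect_matching (W \<union> set xs - {v}) (F \<union> walk_edges (x # xs @ [y])) M"
    unfolding F'_def[symmetric]
  proof (cases "v \<in> W")
    case True
    then obtain M where "perfect_matching (W - {v}) F' M"
      using old by blast
    then have "perfect_matching ((W - {v}) \<union> set xs) F' (M \<union> alternate_edges xs)"
      using inner segment[of "[x]" xs "[y]"] by (intro perfect_matching_Un_segment) auto
    moreover have "(W - {v}) \<union> set xs = W \<union> set xs - {v}"
      using True inner by auto
    ultimately show "\<exists>M. perfect_matching (W \<union> set xs - {v}) F' M"
      by metis
  next
    case False
    then obtain us ws where xs: "xs = us @ v # ws"
      using v by (auto simp: in_set_conv_decomp)
    show "\<exists>M. perfect_matching (W \<union> set xs - {v}) F' M"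
    proof (cases "even (length us)")
      case True
      \<comment> \<open>Here \<open>ws\<close> has odd length, so it borrows the endpoint
        \<open>y\<close>.\<close>
      obtain M where "perfect_matching (W - {y}) F' M"
        using old ends by blast
      then have "perfect_matching ((W - {y}) \<union> set us) F' (M \<union> alternate_edges us)"
        using inner xs True segment[of "[x]" us "v # ws @ [y]"]
        by (intro perfect_matching_Un_segment) auto
      then have "perfect_matching ((W - {y}) \<union> set us \<union> set (ws @ [y])) F'
          (M \<union> alternate_edges us \<union> alternate_edges (ws @ [y]))"
        by (rule perfect_matching_Un_segment)
          (use inner xs True ends segment[of "x # us @ [v]" "ws @ [y]" "[]"] in auto)
      moreover have "(W - {y}) \<union> set us \<union> set (ws @ [y]) = W \<union> set xs - {v}"
        using inner xs ends by auto
      ultimately show ?thesis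
        by metis
    next
      case odd_us: False
      \<comment> \<open>Now \<open>us\<close> is the odd piece and borrows \<open>x\<close>.\<close>
      obtain M where "perfect_matching (W - {x}) F' M"
        using old ends by blast
      then have "perfect_matching ((W - {x}) \<union> set ws) F' (M \<union> alternate_edges ws)"
        using inner xs odd_us segment[of "x # us @ [v]" ws "[y]"]
        by (intro perfect_matching_Un_segment) auto
      then have "perfect_matching ((W - {x}) \<union> set ws \<union> set (x # us)) F'
          (M \<union> alternate_edges ws \<union> alternate_edges (x # us))"
        by (rule perfect_matching_Un_segment)
          (use inner xs odd_us ends segment[of "[]" "x # us" "v # ws @ [y]"] in auto)
      moreover have "(W - {x}) \<union> set ws \<union> set (x # us) = W \<union> set xs - {v}"
        using inner xs ends by auto
      ultimately show ?thesis
        by metis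
    qed
  qed
qed

text \<open>An ear with inner vertices \<open>xs\<close> has \<open>length xs + 1\<close> edges,
  which is odd; it meets the earlier ears only in its ends, so all of \<open>xs\<close> is
  new.\<close>

lemma odd_ear_decomposition_inner:
  assumes "odd_ear_decomposition V E k P" "i < k"
  obtains x xs y where "P (Suc i) = x # xs @ [y]" "distinct xs" "even (length xs)"
    "x \<in> (\<Union>j\<le>i. set (P j))" "y \<in> (\<Union>j\<le>i. set (P j))" "(\<Union>j\<le>i. set (P j)) \<inter> set xs = {}"
proof -
  have ear: "is_path (P (Suc i)) \<or> is_circuit (P (Suc i))" "num_edges (P (Suc i)) \<ge> 1"
    and meet: "set (P (Suc i)) \<inter> (\<Union>j\<le>i. set (P j)) = {hd (P (Suc i)), last (P (Suc i))}"
    and "odd": "odd (num_edges (P (Suc i)))"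
    using assms by (auto simp: odd_ear_decomposition_def ear_decomposition_def
        lessThan_Suc_atMost[symmetric] simp del: UN_simps)
  obtain x xs y where p: "P (Suc i) = x # xs @ [y]"
    and xs: "distinct xs" "x \<notin> set xs" "y \<notin> set xs"
    using ear_inner[OF ear] .
  define W where "W = (\<Union>j\<le>i. set (P j))"
  have meet': "set (P (Suc i)) \<inter> W = {x, y}"
    using meet p by (simp add: W_def)
  then have "{x, y} \<subseteq> W"
    by (metis Int_lower2)
  moreover have "set xs \<inter> W \<subseteq> {x, y}"
    unfolding meet'[symmetric] by (auto simp: p)
  with xs have "W \<inter> set xs = {}"
    by auto
  moreover have "even (length xs)"
    using "odd" p by (simp add: num_edges_def)
  ultimately show thesis
    using p xs by (intro that[of x xs y]) (auto simp: W_def)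
qed

lemma factor_critical_initial_ears:
  assumes "odd_ear_decomposition V E k P" "i \<le> k"
  shows "factor_critical (\<Union>j\<le>i. set (P j)) (\<Union>j\<le>i. walk_edges (P j))"
  using assms(2)
proof (induction i)
  case 0
  have circuit: "is_circuit (P 0)" and "odd": "odd (num_edges (P 0))"
    using assms(1) by (auto simp: odd_ear_decomposition_def ear_decomposition_def)
  then obtain x xs y where p: "P 0 = x # xs @ [y]"
    and xs: "distinct xs" "x \<notin> set xs" "y \<notin> set xs"
    using ear_inner[of "P 0"] by (auto simp: is_circuit_def)
  have "x = y"
    using circuit p by (simp add: is_circuit_def)
  \<comment> \<open>The circuit \<open>P 0\<close> counts as a closed odd ear attached to the
    one-vertex graph, so the base case is another instance of adding an ear.\<close>
  have "factor_critical {x} ({} :: 'a set set)"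
    by (auto simp: factor_critical_def perfect_matching_def matching_def del_vertex_def)
  from factor_critical_add_odd_ear[OF this, of xs x y] show ?case
    using p xs \<open>x = y\<close> "odd" by (simp add: num_edges_def)
next
  case (Suc i)
  then have "i < k"
    by simp
  obtain x xs y where p: "P (Suc i) = x # xs @ [y]" and xs: "distinct xs" "even (length xs)"
    and ends: "x \<in> (\<Union>j\<le>i. set (P j))" "y \<in> (\<Union>j\<le>i. set (P j))"
    and new: "(\<Union>j\<le>i. set (P j)) \<inter> set xs = {}"
    using odd_ear_decomposition_inner[OF assms(1) \<open>i < k\<close>] .
  have "factor_critical (\<Union>j\<le>i. set (P j)) (\<Union>j\<le>i. walk_edges (P j))"
    using Suc by simp
  from factor_critical_add_odd_ear[OF this xs new ends]
  have "factor_critical ((\<Union>j\<le>i. set (P j)) \<union> set xs)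
      ((\<Union>j\<le>i. walk_edges (P j)) \<union> walk_edges (P (Suc i)))"
    by (simp only: p)
  moreover have "(\<Union>j\<le>Suc i. set (P j)) = (\<Union>j\<le>i. set (P j)) \<union> set xs"
    using p ends by (auto simp: atMost_Suc)
  moreover have "(\<Union>j\<le>Suc i. walk_edges (P j)) =
      (\<Union>j\<le>i. walk_edges (P j)) \<union> walk_edges (P (Suc i))"
    by (auto simp: atMost_Suc)
  ultimately show ?case
    by simp
qed

section \<open>Extending a matching over further ears\<close>

text \<open>The added edges are named explicitly, so that a particular edge can later be recognised
  among them. They come from the inner vertices of the ear; a trivial ear adds nothing.\<close>

lemma perfect_matching_add_ear:
  assumes "odd_ear_decomposition V E k P" "i < k"
    and v: "v \<in> (\<Union>j\<le>i. set (P j))"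
    and pm: "perfect_matching ((\<Union>j\<le>i. set (P j)) - {v}) E M"
  shows "perfect_matching ((\<Union>j\<le>Suc i. set (P j)) - {v}) E
    (M \<union> alternate_edges (butlast (tl (P (Suc i)))))"
proof -
  obtain x xs y where p: "P (Suc i) = x # xs @ [y]" and xs: "distinct xs" "even (length xs)"
    and ends: "x \<in> (\<Union>j\<le>i. set (P j))" "y \<in> (\<Union>j\<le>i. set (P j))"
    and new: "(\<Union>j\<le>i. set (P j)) \<inter> set xs = {}"
    using odd_ear_decomposition_inner[OF assms(1,2)] .
  have "walk_edges (P (Suc i)) \<subseteq> E"
    using assms(1,2) by (auto simp: odd_ear_decomposition_def ear_decomposition_def)
  then have "walk_edges xs \<subseteq> E"
    using walk_edges_infix[of xs "[x]" "[y]"] p by auto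
  then have "perfect_matching (((\<Union>j\<le>i. set (P j)) - {v}) \<union> set xs) E (M \<union> alternate_edges xs)"
    using xs new by (intro perfect_matching_Un_segment[OF pm]) blast+
  moreover have "(\<Union>j\<le>Suc i. set (P j)) = (\<Union>j\<le>i. set (P j)) \<union> set xs"
    using p ends by (auto simp: atMost_Suc)
  then have "(\<Union>j\<le>Suc i. set (P j)) - {v} = ((\<Union>j\<le>i. set (P j)) - {v}) \<union> set xs"
    using v new by blast
  ultimately show ?thesis
    using p by (simp add: butlast_append)
qed

text \<open>Each further ear only adds edges, so an edge already chosen in \<open>M\<close>
  survives.\<close>

lemma perfect_matching_extend:
  assumes "odd_ear_decomposition V E k P"
    and v: "v \<in> (\<Union>j\<le>i. set (P j))"
    and pm: "perfect_matching ((\<Union>j\<le>i. set (P j)) - {v}) E M"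
    and "i \<le> l" "l \<le> k"
  shows "\<exists>N. M \<subseteq> N \<and> perfect_matching ((\<Union>j\<le>l. set (P j)) - {v}) E N"
  using assms(4,5)
proof (induction l rule: dec_induct)
  case base
  then show ?case using pm by blast
next
  case (step l)
  then obtain N where N: "M \<subseteq> N" "perfect_matching ((\<Union>j\<le>l. set (P j)) - {v}) E N"
    by auto
  have "v \<in> (\<Union>j\<le>l. set (P j))"
    using v \<open>i \<le> l\<close> by force
  from perfect_matching_add_ear[OF assms(1) _ this N(2)] step.prems
  have "perfect_matching ((\<Union>j\<le>Suc l. set (P j)) - {v}) E
      (N \<union> alternate_edges (butlast (tl (P (Suc l)))))"
    by simp
  with N(1) show ?case
    by (intro exI conjI) auto
qed

section \<open>Parity of positions along an ear\<close>

text \<open>In a closed ear \<open>x = y\<close>, and then a path to \<open>x\<close> cannot pass beyond \<open>x\<close> because it ends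
  there; so it stays in the initial segment of \<open>p\<close> and every step changes the position by one.\<close>

lemma parity_of_path_to_end:
  fixes us ws :: "'a list"
  defines "n \<equiv> Suc (length us)"
  assumes p: "p = x # us @ c # d # ws @ [y]" "distinct (us @ c # d # ws)"
    "x \<notin> set (us @ c # d # ws)" "y \<notin> set (us @ c # d # ws)"
    and q: "q \<noteq> []" "distinct q" "walk_edges q \<subseteq> walk_edges p" "d \<notin> set q" "last q \<in> {x, y}"
    and j: "j \<le> n" "hd q = p ! j"
  shows "even (num_edges q) \<longleftrightarrow> even j"
  using q j
proof (induction q arbitrary: j rule: induct_list012)
  case (2 z)
  \<comment> \<open>The single vertex is an end of \<open>p\<close>, whereas positions 1 to
    \<open>n\<close> hold the inner vertices \<open>us @ [c]\<close>.\<close>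
  have "j = 0"
  proof (rule ccontr)
    assume "j \<noteq> 0"
    with 2 obtain i where "j = Suc i" "i < length (us @ [c])"
      by (cases j) (auto simp: n_def)
    then have "p ! j \<in> set (us @ [c])"
      using nth_mem[of i "us @ [c]"] by (auto simp: p(1) nth_append split: if_splits)
    then show False
      using 2 p(3,4) by auto
  qed
  then show ?case
    by (simp add: num_edges_def)
next
  case (3 z w q)
  have pn: "p ! n = c" "p ! Suc n = d"
    by (simp_all add: p(1) n_def nth_append)
  have len: "length p = Suc (length (us @ c # d # ws) + 1)"
    by (simp add: p(1))
  have dist: "distinct (tl p)" "distinct (butlast p)"
    using p by (auto simp: butlast_append)
  have nth0: "p ! 0 = x" and last_p: "p ! (length p - 1) = y"
    using p(1) by (auto simp: nth_append)
  \<comment> \<open>With \<open>x = y\<close>, a path standing at position 0 is already at its last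
    vertex and would have to repeat it.\<close>
  have closed: "\<not> (x = y \<and> j = 0)"
  proof
    assume "x = y \<and> j = 0"
    then have "z = last (w # q)"
      using "3.prems" nth0 by auto
    then show False
      using "3.prems"(2) last_in_set[of "w # q"] by auto
  qed
  have j_less: "j < length p - 1"
    using "3.prems" by (simp add: p(1) n_def)
  \<comment> \<open>The only repetition possible in \<open>p\<close> is \<open>x = y\<close> at its
    two ends, and \<open>closed\<close> excludes it when \<open>j = 0\<close>.\<close>
  have index: "l = j" if "l < length p" "p ! l = p ! j" for l
  proof (cases "l < length p - 1")
    case True
    then show ?thesis
      using that j_less dist(2) by (metis length_butlast nth_butlast nth_eq_iff_index_eq)
  next
    case False
    then have l: "l = length p - 1"
      using that by simp
    have "j \<noteq> 0"
    proof
      assume "j = 0"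
      then show False
        using closed nth0 last_p that(2) l by auto
    qed
    then obtain l' j' where "l = Suc l'" "j = Suc j'"
      using l j_less by (metis Suc_pred gr0I not_less0)
    moreover from this have "tl p ! l' = tl p ! j'"
      using that l j_less by (simp add: nth_tl)
    ultimately show ?thesis
      using dist(1) l j_less nth_eq_iff_index_eq[of "tl p" l' j'] by simp
  qed
  have "{z, w} \<in> walk_edges p"
    using "3.prems" by (simp add: walk_edges_Cons)
  then obtain l where l: "Suc l < length p" "{z, w} = {p ! l, p ! Suc l}"
    by (auto simp: walk_edges_def)
  have z: "z = p ! j"
    using "3.prems" by simp
  \<comment> \<open>One step changes the position by one and cannot leave the range up to
    \<open>n\<close>, because position \<open>Suc n\<close> holds the avoided vertex
    \<open>d\<close>.\<close>
  have "\<exists>j'\<le>n. w = p ! j' \<and> (even j' \<longleftrightarrow> odd j)"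
  proof -
    consider "z = p ! l" "w = p ! Suc l" | "z = p ! Suc l" "w = p ! l"
      using l(2) by (auto simp: doubleton_eq_iff)
    then show ?thesis
    proof cases
      case 1
      then have "l = j"
        using index l(1) z by simp
      moreover have "j \<noteq> n"
        using 1 \<open>l = j\<close> pn "3.prems" by auto
      ultimately show ?thesis
        using 1 "3.prems" by (intro exI[of _ "Suc j"]) auto
    next
      case 2
      then have "Suc l = j"
        using index l(1) z by simp
      then show ?thesis
        using 2 "3.prems" by (intro exI[of _ l]) auto
    qed
  qed
  then obtain j' where j': "j' \<le> n" "w = p ! j'" "even j' \<longleftrightarrow> odd j"
    by blast
  have "even (num_edges (w # q)) \<longleftrightarrow> even j'"
    using "3.prems" j' by (intro "3.IH") (auto simp: walk_edges_Cons)
  then show ?case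
    using j'(3) by (simp add: num_edges_def)
qed simp

text \<open>A path from \<open>p ! m\<close> that avoids \<open>p ! Suc m\<close> can only run back
  to the start of \<open>p\<close>, so its length has the parity of \<open>m\<close>. Hence
  \<open>m\<close> is odd, an even number of inner vertices precede \<open>p ! m\<close>, and the
  edge forms a pair.\<close>

lemma alternate_edges_oddly_joined:
  assumes "p = x # xs @ [y]" "distinct xs" "x \<notin> set xs" "y \<notin> set xs"
    and "Suc m < length p" "p ! m \<in> set xs" "p ! Suc m \<in> set xs"
    and joined: "oddly_joined_avoiding p (p ! m) (p ! Suc m)"
  shows "{p ! m, p ! Suc m} \<in> alternate_edges xs"
proof -
  define c d where "c = p ! m" and "d = p ! Suc m"
  have "m \<noteq> 0"
    using assms by (cases m) auto
  \<comment> \<open>\<open>m'\<close> is the position in \<open>xs\<close>, one less than in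
    \<open>p\<close> because \<open>x\<close> stands in front.\<close>
  then obtain m' where m: "m = Suc m'"
    using not0_implies_Suc by blast
  have "m' < length xs" "Suc m' \<noteq> length xs"
    using assms m by (auto simp: nth_append)
  then have m': "Suc m' < length xs"
    by simp
  define us ws where "us = take m' xs" and "ws = drop (Suc (Suc m')) xs"
  have "c = xs ! m'" "d = xs ! Suc m'"
    using m m' assms(1) by (simp_all add: c_def d_def nth_append)
  then have xs: "xs = us @ c # d # ws"
    using m' by (simp add: us_def ws_def Cons_nth_drop_Suc)
  have p: "p = x # us @ c # d # ws @ [y]"
    using assms(1) xs by simp
  obtain q where q: "subpath_of q p" "hd q = c" "last q \<in> {x, y}" "odd (num_edges q)" "d \<notin> set q"
    using joined assms(1) by (auto simp: oddly_joined_avoiding_def c_def d_def)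
  have "c = p ! Suc (length us)"
    by (simp add: p nth_append)
  then have "even (num_edges q) \<longleftrightarrow> even (Suc (length us))"
    using p assms(2-4) q xs
    by (intro parity_of_path_to_end[of p x us c d ws y]) (auto simp: subpath_of_def is_path_def)
  then have "even (length us)"
    using q(4) by simp
  then show ?thesis
    by (simp add: xs alternate_edges_append flip: c_def d_def)
qed

section \<open>The first ear containing a vertex\<close>

lemma
  assumes "u \<in> (\<Union>i\<le>k. set (P i))"
  shows ear_le: "ear k P u \<le> k"
    and ear_mem: "u \<in> set (P (ear k P u))"
    and ear_least: "i \<le> k \<Longrightarrow> u \<in> set (P i) \<Longrightarrow> ear k P u \<le> i"
proof -
  have "ear k P u \<le> k \<and> u \<in> set (P (ear k P u))"
    unfolding ear_def using assms LeastI_ex[of "\<lambda>i. i \<le> k \<and> u \<in> set (P i)"] by auto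
  then show "ear k P u \<le> k" "u \<in> set (P (ear k P u))"
    by auto
  show "i \<le> k \<Longrightarrow> u \<in> set (P i) \<Longrightarrow> ear k P u \<le> i"
    unfolding ear_def using Least_le[of "\<lambda>i. i \<le> k \<and> u \<in> set (P i)" i] by simp
qed

text \<open>If \<open>a\<close> were older than \<open>P i\<close>, so would be \<open>b\<close>,
  and both would be ends of \<open>P i\<close>; but two consecutive vertices of a nontrivial ear
  include an inner one, and inner vertices are new.\<close>

lemma nontrivial_ear_of_edge:
  assumes decomp: "odd_ear_decomposition V E k P"
    and "i \<le> k" "\<not> trivial_ear (P i)" "{a, b} \<in> walk_edges (P i)"
    and "ear k P a = ear k P b"
  shows "ear k P a = i"
proof (rule ccontr)
  assume neq: "ear k P a \<noteq> i"
  have ab: "a \<in> set (P i)" "b \<in> set (P i)"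
    using walk_edges_subset[OF assms(4)] by auto
  then have abV: "a \<in> (\<Union>i\<le>k. set (P i))" "b \<in> (\<Union>i\<le>k. set (P i))"
    using assms(2) by auto
  have less: "ear k P a < i"
    using ear_least[OF abV(1) assms(2) ab(1)] neq by simp
  then obtain i' where i': "i = Suc i'"
    by (cases i) auto
  then obtain x xs y where p: "P i = x # xs @ [y]"
    and new: "(\<Union>j\<le>i'. set (P j)) \<inter> set xs = {}"
    using odd_ear_decomposition_inner[OF decomp, of i'] assms(2) by (metis Suc_le_eq)
  have "a \<in> (\<Union>j\<le>i'. set (P j))" "b \<in> (\<Union>j\<le>i'. set (P j))"
    using ear_mem[OF abV(1)] ear_mem[OF abV(2)] assms(5) less i' by auto
  then have "a \<notin> set xs" "b \<notin> set xs"
    using new by auto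
  moreover obtain m where m: "Suc m < length (P i)" "{a, b} = {P i ! m, P i ! Suc m}"
    using assms(4) by (auto simp: walk_edges_def)
  ultimately have out: "P i ! m \<notin> set xs" "P i ! Suc m \<notin> set xs"
    by (metis insert_iff empty_iff)+
  have "length xs \<noteq> 0"
    using assms(3) p by (simp add: trivial_ear_def num_edges_def)
  then have "P i ! m \<in> set xs \<or> P i ! Suc m \<in> set xs"
    using m(1) p by (cases m) (auto simp: nth_append)
  with out show False
    by blast
qed

theorem lemma2p1:
  fixes V :: "'a set" and E :: "'a set set" and k :: nat and P :: "nat \<Rightarrow> 'a list"
    and a b v :: 'a
  assumes "simple_graph V E"
    and "factor_critical V E"
    and "odd_ear_decomposition V E k P"
    and "odd_edge E k P a b"
    and "\<exists>i\<le>k. \<not> trivial_ear (P i) \<and> {a, b} \<in> walk_edges (P i)"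
    and "v \<in> V"
    and "ear k P v < ear k P a"
  shows "\<exists>M. perfect_matching (V - {v}) (del_vertex E v) M \<and> {a, b} \<in> M"
proof -
  have V: "(\<Union>i\<le>k. set (P i)) = V" and E: "(\<Union>i\<le>k. walk_edges (P i)) = E"
    using assms(3) by (auto simp: odd_ear_decomposition_def ear_decomposition_def)
  have ears: "ear k P a = ear k P b"
    using assms(4) by (simp add: odd_edge_def)
  \<comment> \<open>As \<open>v\<close> has a smaller index, the ear of \<open>a\<close> is not
    \<open>P 0\<close>, and the parity condition on odd edges applies.\<close>
  obtain i where i: "ear k P a = Suc i"
    using assms(7) by (cases "ear k P a") auto
  have ab: "{a, b} \<in> walk_edges (P (Suc i))" and "Suc i \<le> k"
    using assms(5) nontrivial_ear_of_edge[OF assms(3) _ _ _ ears] i by auto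
  then have "i < k"
    by simp
  have ab_mem: "a \<in> set (P (Suc i))" "b \<in> set (P (Suc i))"
    using walk_edges_subset[OF ab] by auto
  then have abV: "a \<in> (\<Union>i\<le>k. set (P i))" "b \<in> (\<Union>i\<le>k. set (P i))"
    using \<open>Suc i \<le> k\<close> by auto
  define W where "W = (\<Union>j\<le>i. set (P j))"
  have old: "u \<notin> W" if "u \<in> {a, b}" for u
  proof
    assume "u \<in> W"
    then obtain j where "j \<le> i" "u \<in> set (P j)"
      by (auto simp: W_def)
    moreover have "u \<in> (\<Union>i\<le>k. set (P i))" "ear k P u = Suc i"
      using that abV i ears by auto
    ultimately show False
      using ear_least[of u P k j] \<open>i < k\<close> by simp
  qed
  obtain x xs y where p: "P (Suc i) = x # xs @ [y]" and xs: "distinct xs" "even (length xs)"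
    and ends: "x \<in> W" "y \<in> W"
    and new: "W \<inter> set xs = {}"
    using odd_ear_decomposition_inner[OF assms(3) \<open>i < k\<close>, folded W_def] .
  have inner: "a \<in> set xs" "b \<in> set xs"
    using ab_mem old[of a] old[of b] ends unfolding p by auto
  obtain m where m: "Suc m < length (P (Suc i))"
    and m_ab: "{a, b} = {P (Suc i) ! m, P (Suc i) ! Suc m}"
    using ab by (auto simp: walk_edges_def)
  have joined: "oddly_joined_avoiding (P (Suc i)) a b" "oddly_joined_avoiding (P (Suc i)) b a"
    using assms(4) i by (auto simp: odd_edge_def)
  \<comment> \<open>The ear may traverse the edge in either direction; whichever of \<open>a\<close>
    and \<open>b\<close> comes first supplies the required path to an end.\<close>
  have "{P (Suc i) ! m, P (Suc i) ! Suc m} \<in> alternate_edges xs"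
  proof (rule alternate_edges_oddly_joined[OF p xs(1) _ _ m])
    show "x \<notin> set xs" "y \<notin> set xs"
      using ends new by blast+
    show "P (Suc i) ! m \<in> set xs" "P (Suc i) ! Suc m \<in> set xs"
      "oddly_joined_avoiding (P (Suc i)) (P (Suc i) ! m) (P (Suc i) ! Suc m)"
      using m_ab inner joined by (auto simp: doubleton_eq_iff)
  qed
  then have e: "{a, b} \<in> alternate_edges (butlast (tl (P (Suc i))))"
    using p m_ab by (simp add: butlast_append)
  have v: "v \<in> W"
    using ear_mem[of v P k] assms(6,7) V i by (auto simp: W_def)
  \<comment> \<open>Factor-criticality of the first ears gives a matching in their own edges, to be
    regarded as one in \<open>E\<close>.\<close>
  have "(\<Union>j\<le>i. walk_edges (P j)) \<subseteq> E"
    unfolding E[symmetric] using \<open>i < k\<close> by (intro UN_mono) auto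
  then obtain M where "perfect_matching (W - {v}) E M"
    using factor_critical_initial_ears[OF assms(3) less_imp_le[OF \<open>i < k\<close>], folded W_def] v
    unfolding factor_critical_def perfect_matching_del_vertex
    by (metis perfect_matching_mono)
  then have "perfect_matching ((\<Union>j\<le>Suc i. set (P j)) - {v}) E
      (M \<union> alternate_edges (butlast (tl (P (Suc i)))))"
    using perfect_matching_add_ear[OF assms(3) \<open>i < k\<close>, folded W_def] v by simp
  moreover have "v \<in> (\<Union>j\<le>Suc i. set (P j))"
    using v by (auto simp: W_def atMost_Suc)
  ultimately obtain N where "M \<union> alternate_edges (butlast (tl (P (Suc i)))) \<subseteq> N"
    "perfect_matching (V - {v}) E N"
    using perfect_matching_extend[OF assms(3) _ _ \<open>Suc i \<le> k\<close> order_refl] unfolding V by metis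
  then show ?thesis
    unfolding perfect_matching_del_vertex using e by (intro exI[of _ N]) auto
qed

end
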